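(* Let $C$ be the Cesàro operator on $L^2(0,1)$, $(Cf)(x)=\frac1x\int_0^x\frac{f(t)}{1-t}\,dt$. Its Hilbert space adjoint $C^*$ satisfies, for every $f\in L^2(0,1)$, $$(C^*f)(x)=\frac{1}{1-x}\int_x^1\frac{f(t)}{t}\,dt,\qquad 0<x<1.$$
   Context: $L^2(0,1)$ is the Hilbert space of complex-valued square-integrable functions on $(0,1)$ with respect to Lebesgue measure; $C$ is a bounded linear operator on it. Equalities of functions are understood almost everywhere. *)

theory Defs
  imports "HOL-Analysis.Analysis"
begin

section \<open>The complex Hilbert space $L^2(0,1)$\<close>

abbreviation leb01 :: "real measure" where
  "leb01 \<equiv> lebesgue_on {0<..<1}"

text \<open>
  Functions are total on the reals, but only their values on $(0,1)$ matter: the values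
  elsewhere are invisible to the measure \<open>leb01\<close> and hence are identified in the quotient.
\<close>

definition square_integrable :: "(real \<Rightarrow> complex) \<Rightarrow> bool" where
  "square_integrable f \<longleftrightarrow>
     f \<in> borel_measurable leb01 \<and> integrable leb01 (\<lambda>x. (cmod (f x))\<^sup>2)"

definition L2_rel :: "(real \<Rightarrow> complex) \<Rightarrow> (real \<Rightarrow> complex) \<Rightarrow> bool" where
  "L2_rel f g \<longleftrightarrow> square_integrable f \<and> square_integrable g \<and> (AE x in leb01. f x = g x)"

lemma square_integrable_zero: "square_integrable (\<lambda>_. 0)"
  by (simp add: square_integrable_def)

lemma square_integrable_measurable [measurable_dest]:
  "square_integrable f \<Longrightarrow> f \<in> borel_measurable leb01"
  by (simp add: square_integrable_def)

lemma square_integrable_add: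
  assumes "square_integrable f" "square_integrable g"
  shows "square_integrable (\<lambda>x. f x + g x)"
proof -
  have [measurable]: "f \<in> borel_measurable leb01" "g \<in> borel_measurable leb01"
    using assms by (auto simp: square_integrable_def)
  have "integrable leb01 (\<lambda>x. 2 * (cmod (f x))\<^sup>2 + 2 * (cmod (g x))\<^sup>2)"
    using assms by (auto simp: square_integrable_def)
  then have "integrable leb01 (\<lambda>x. (cmod (f x + g x))\<^sup>2)"
  proof (rule Bochner_Integration.integrable_bound)
    show "AE x in leb01. norm ((cmod (f x + g x))\<^sup>2)
        \<le> norm (2 * (cmod (f x))\<^sup>2 + 2 * (cmod (g x))\<^sup>2)"
    proof (rule AE_I2)
      fix x
      have "(cmod (f x + g x))\<^sup>2 \<le> (cmod (f x) + cmod (g x))\<^sup>2"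
        by (simp add: norm_triangle_ineq power_mono)
      also have "\<dots> \<le> 2 * (cmod (f x))\<^sup>2 + 2 * (cmod (g x))\<^sup>2"
        using sum_squares_bound[of "cmod (f x)" "cmod (g x)"] by (simp add: power2_sum)
      finally show "norm ((cmod (f x + g x))\<^sup>2)
          \<le> norm (2 * (cmod (f x))\<^sup>2 + 2 * (cmod (g x))\<^sup>2)" by simp
    qed
  qed measurable
  then show ?thesis by (simp add: square_integrable_def)
qed

lemma square_integrable_scale:
  assumes "square_integrable f"
  shows "square_integrable (\<lambda>x. c * f x)"
  using assms by (auto simp: square_integrable_def norm_mult power_mult_distrib)

lemma borel_measurable_cnj [measurable]:
  fixes f :: "'a \<Rightarrow> complex"
  assumes "f \<in> borel_measurable M"
  shows "(\<lambda>x. cnj (f x)) \<in> borel_measurable M"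
  using assms by (rule measurable_compose[OF _ borel_measurable_continuous_onI])
    (intro continuous_intros)

lemma square_integrable_product:
  assumes "square_integrable f" "square_integrable g"
  shows "integrable leb01 (\<lambda>x. f x * cnj (g x))"
proof -
  have [measurable]: "f \<in> borel_measurable leb01" "g \<in> borel_measurable leb01"
    using assms by (auto simp: square_integrable_def)
  have "integrable leb01 (\<lambda>x. (cmod (f x))\<^sup>2 + (cmod (g x))\<^sup>2)"
    using assms by (auto simp: square_integrable_def)
  then show ?thesis
  proof (rule Bochner_Integration.integrable_bound)
    show "AE x in leb01. norm (f x * cnj (g x)) \<le> norm ((cmod (f x))\<^sup>2 + (cmod (g x))\<^sup>2)"
    proof (rule AE_I2)
      fix x
      have "2 * (cmod (f x) * cmod (g x)) \<le> (cmod (f x))\<^sup>2 + (cmod (g x))\<^sup>2"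
        using sum_squares_bound[of "cmod (f x)" "cmod (g x)"] by simp
      moreover have "0 \<le> cmod (f x) * cmod (g x)" by simp
      ultimately have "cmod (f x) * cmod (g x) \<le> (cmod (f x))\<^sup>2 + (cmod (g x))\<^sup>2"
        by linarith
      then show "norm (f x * cnj (g x)) \<le> norm ((cmod (f x))\<^sup>2 + (cmod (g x))\<^sup>2)"
        by (simp add: norm_mult)
    qed
  qed measurable
qed

quotient_type L2 = "real \<Rightarrow> complex" / partial: L2_rel
proof (rule part_equivpI)
  show "\<exists>f. L2_rel f f"
    using square_integrable_zero by (auto simp: L2_rel_def)
  show "symp L2_rel"
    by (auto simp: symp_def L2_rel_def elim!: eventually_mono)
  show "transp L2_rel"
  proof (rule transpI)
    fix f g h
    assume "L2_rel f g" "L2_rel g h"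
    then show "L2_rel f h" unfolding L2_rel_def by (auto elim: eventually_elim2)
  qed
qed

lemma square_integrable_rep_L2: "square_integrable (rep_L2 F)"
  using Quotient3_rep_reflp[OF Quotient3_L2] by (auto simp: L2_rel_def)

lemma rep_abs_L2:
  "square_integrable f \<Longrightarrow> AE x in leb01. rep_L2 (abs_L2 f) x = f x"
  using rep_abs_rsp_left[OF Quotient3_L2, of f f] by (auto simp: L2_rel_def)

instantiation L2 :: real_vector
begin

lift_definition zero_L2 :: L2 is "\<lambda>_. 0"
  by (simp add: L2_rel_def square_integrable_zero)

lift_definition plus_L2 :: "L2 \<Rightarrow> L2 \<Rightarrow> L2" is "\<lambda>f g x. f x + g x"
  by (auto simp: L2_rel_def intro: square_integrable_add elim: eventually_elim2)

lift_definition uminus_L2 :: "L2 \<Rightarrow> L2" is "\<lambda>f x. - f x"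
  using square_integrable_scale[of _ "-1"]
  by (auto simp: L2_rel_def elim: eventually_mono)

definition minus_L2 :: "L2 \<Rightarrow> L2 \<Rightarrow> L2" where
  "minus_L2 F G = F + - G"

lift_definition scaleR_L2 :: "real \<Rightarrow> L2 \<Rightarrow> L2" is "\<lambda>r f x. complex_of_real r * f x"
  by (auto simp: L2_rel_def intro: square_integrable_scale elim: eventually_mono)

instance
proof
  fix a b :: real and F G H :: L2
  show "F + G + H = F + (G + H)"
    by transfer (simp add: L2_rel_def square_integrable_add add.assoc)
  show "F + G = G + F"
    by transfer (simp add: L2_rel_def square_integrable_add add.commute)
  show "0 + F = F"
    by transfer (simp add: L2_rel_def)
  show "- F + F = 0"
    by transfer (simp add: L2_rel_def square_integrable_zero)
  show "F - G = F + - G"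
    by (fact minus_L2_def)
  show "a *\<^sub>R (F + G) = a *\<^sub>R F + a *\<^sub>R G"
    by transfer (simp add: L2_rel_def square_integrable_add square_integrable_scale distrib_left)
  show "(a + b) *\<^sub>R F = a *\<^sub>R F + b *\<^sub>R F"
    by transfer (simp add: L2_rel_def square_integrable_add square_integrable_scale distrib_right)
  show "a *\<^sub>R b *\<^sub>R F = (a * b) *\<^sub>R F"
    by transfer (auto simp: L2_rel_def mult.assoc intro: square_integrable_scale
        dest: square_integrable_scale[of _ "complex_of_real a * complex_of_real b"])
  show "1 *\<^sub>R F = F"
    by transfer (simp add: L2_rel_def)
qed

end

lift_definition scaleC_L2 :: "complex \<Rightarrow> L2 \<Rightarrow> L2"  (infixr \<open>*\<^sub>C\<close> 75) is "\<lambda>c f x. c * f x"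
  by (auto simp: L2_rel_def intro: square_integrable_scale elim: eventually_mono)

text \<open>
  The inner product is linear in its first argument. Its real part provides the instance of the
  class \<open>real_inner\<close> below, whose norm is the $L^2$ norm.
\<close>

lift_definition cinner :: "L2 \<Rightarrow> L2 \<Rightarrow> complex" is
  "\<lambda>f g. LINT x|leb01. f x * cnj (g x)"
proof -
  fix f f' g g' assume fg: "L2_rel f f'" "L2_rel g g'"
  then have "AE x in leb01. f x * cnj (g x) = f' x * cnj (g' x)"
    unfolding L2_rel_def by (auto elim: eventually_elim2)
  moreover have "integrable leb01 (\<lambda>x. f x * cnj (g x))" "integrable leb01 (\<lambda>x. f' x * cnj (g' x))"
    using fg square_integrable_product by (auto simp: L2_rel_def)
  ultimately show "(LINT x|leb01. f x * cnj (g x)) = (LINT x|leb01. f' x * cnj (g' x))"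
    by (intro integral_cong_AE) auto
qed

lemma cinner_add_left: "cinner (F + G) H = cinner F H + cinner G H"
  by transfer (simp add: L2_rel_def distrib_right square_integrable_product)

lemma cinner_scaleC_left: "cinner (c *\<^sub>C F) G = c * cinner F G"
  by transfer (simp add: mult.assoc)

lemma cinner_commute: "cinner F G = cnj (cinner G F)"
proof transfer
  fix f g
  have "cnj (LINT x|leb01. g x * cnj (f x)) = (LINT x|leb01. cnj (g x * cnj (f x)))"
    by (simp only: Bochner_Integration.integral_cnj)
  then show "(LINT x|leb01. f x * cnj (g x)) = cnj (LINT x|leb01. g x * cnj (f x))"
    by (simp add: mult.commute)
qed

lemma cinner_self:
  "cinner F F = complex_of_real (LINT x|leb01. (cmod (rep_L2 F x))\<^sup>2)"
proof -
  have "cinner F F = (LINT x|leb01. complex_of_real ((cmod (rep_L2 F x))\<^sup>2))"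
    by (simp add: cinner_def complex_norm_square del: of_real_power)
  also have "\<dots> = complex_of_real (LINT x|leb01. (cmod (rep_L2 F x))\<^sup>2)"
    using square_integrable_rep_L2[of F]
    by (intro integral_of_real) (simp add: square_integrable_def)
  finally show ?thesis .
qed

lemma cinner_self_eq_0: "cinner F F = 0 \<longleftrightarrow> F = 0"
proof
  assume "cinner F F = 0"
  then have 0: "(LINT x|leb01. (cmod (rep_L2 F x))\<^sup>2) = 0"
    unfolding cinner_self by simp
  have "AE x in leb01. (cmod (rep_L2 F x))\<^sup>2 = 0"
    using 0 square_integrable_rep_L2[of F]
    by (subst (asm) integral_nonneg_eq_0_iff_AE) (auto simp: square_integrable_def)
  then have "L2_rel (rep_L2 F) (\<lambda>_. 0)"
    using square_integrable_rep_L2[of F] square_integrable_zero by (auto simp: L2_rel_def)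
  then show "F = 0"
    by (metis Quotient3_L2 Quotient3_abs_rep Quotient3_rel zero_L2_def)
next
  assume "F = 0"
  then show "cinner F F = 0"
    using cinner_scaleC_left[of 0 0 0] cinner_add_left[of 0 0 0] by simp
qed

instantiation L2 :: real_inner
begin

definition inner_L2 :: "L2 \<Rightarrow> L2 \<Rightarrow> real" where
  "inner_L2 F G = Re (cinner F G)"

definition norm_L2 :: "L2 \<Rightarrow> real" where
  "norm_L2 F = sqrt (inner F F)"

definition sgn_L2 :: "L2 \<Rightarrow> L2" where
  "sgn_L2 F = F /\<^sub>R norm F"

definition dist_L2 :: "L2 \<Rightarrow> L2 \<Rightarrow> real" where
  "dist_L2 F G = norm (F - G)"

definition uniformity_L2 :: "(L2 \<times> L2) filter" where
  "uniformity_L2 = (INF e\<in>{0<..}. principal {(x, y). dist x y < e})"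

definition open_L2 :: "L2 set \<Rightarrow> bool" where
  "open_L2 U \<longleftrightarrow> (\<forall>x\<in>U. eventually (\<lambda>(x', y). x' = x \<longrightarrow> y \<in> U) uniformity)"

lemma scaleR_L2_scaleC: "r *\<^sub>R F = complex_of_real r *\<^sub>C (F :: L2)"
  by (simp add: scaleR_L2_def scaleC_L2_def)

instance
proof
  fix F G H :: L2 and r :: real
  show "inner F G = inner G F"
    unfolding inner_L2_def by (subst cinner_commute) simp
  show "inner (F + G) H = inner F H + inner G H"
    by (simp add: inner_L2_def cinner_add_left)
  show "inner (r *\<^sub>R F) G = r * inner F G"
    by (simp add: inner_L2_def scaleR_L2_scaleC cinner_scaleC_left)
  show "0 \<le> inner F F"
    by (simp add: inner_L2_def cinner_self)
  show "inner F F = 0 \<longleftrightarrow> F = 0"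
    unfolding cinner_self_eq_0[symmetric] by (simp add: inner_L2_def cinner_self)
qed (fact norm_L2_def sgn_L2_def dist_L2_def uniformity_L2_def open_L2_def)+

end

section \<open>The Hilbert space adjoint\<close>

text \<open>
  At most one function \<open>S\<close> has the defining property, because the inner product is definite
  (see \<open>hilbert_adjoint_eqI\<close>); on an operator without an adjoint the value is arbitrary.
\<close>

definition hilbert_adjoint :: "(L2 \<Rightarrow> L2) \<Rightarrow> (L2 \<Rightarrow> L2)" where
  "hilbert_adjoint T = (THE S. \<forall>F G. cinner (T F) G = cinner F (S G))"

lemma hilbert_adjoint_eqI:
  assumes "\<And>F G. cinner (T F) G = cinner F (S G)"
  shows "hilbert_adjoint T = S"
  unfolding hilbert_adjoint_def
proof (rule the_equality)
  show "\<forall>F G. cinner (T F) G = cinner F (S G)" using assms by blast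
  fix S' assume S': "\<forall>F G. cinner (T F) G = cinner F (S' G)"
  show "S' = S"
  proof
    fix G
    have *: "cinner (S' G) F = cinner (S G) F" for F
      using S' assms cinner_commute by metis
    have "cinner (S' G - S G) (S' G - S G) = 0"
      using cinner_add_left[of "S' G - S G" "S G" "S' G - S G"] * by simp
    then show "S' G = S G" by (simp add: cinner_self_eq_0)
  qed
qed

section \<open>The Cesaro operator\<close>

definition cesaro_fun :: "(real \<Rightarrow> complex) \<Rightarrow> real \<Rightarrow> complex" where
  "cesaro_fun f x =
     1 / complex_of_real x * (LINT t:{0<..<x}|lebesgue. f t / (1 - complex_of_real t))"

lemma sigma_finite_leb01: "sigma_finite_measure leb01"
  using finite_measure_lebesgue_on[of "{0<..<1::real}"] by (simp add: finite_measure_def)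

text \<open>
  That the operator maps $L^2(0,1)$ to itself (with norm at most 2) is Schur's test with the
  weight $1/\sqrt{t(1-t)}$.
\<close>

lemma weight_integral_left:
  assumes "0 < x" "x < (1::real)"
  shows "(\<integral>\<^sup>+t. ennreal (indicator {0<..<x} t / (x * (1 - t)) * (1 / sqrt (t * (1 - t)))) \<partial>leb01)
    = ennreal (2 * (1 / sqrt (x * (1 - x))))"
proof -
  let ?h = "\<lambda>t. 1 / (x * (1 - t)) * (1 / sqrt (t * (1 - t)))"
  let ?F = "\<lambda>t. 2 / x * sqrt (t / (1 - t))"
  have "(?h has_integral (?F x - ?F 0)) {0..x}"
  proof (rule fundamental_theorem_of_calculus_interior)
    show "continuous_on {0..x} ?F"
      using assms by (intro continuous_intros) auto
    fix t assume t: "t \<in> {0<..<x}"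
    then have t': "0 < t" "t < 1" using assms by auto
    have d1: "((\<lambda>t. t / (1 - t)) has_real_derivative 1 / (1 - t)\<^sup>2) (at t)"
      using t' by (auto intro!: derivative_eq_intros simp: field_simps power2_eq_square)
    have "0 < t / (1 - t)" using t' by simp
    then have "((\<lambda>t. sqrt (t / (1 - t))) has_real_derivative
        inverse (sqrt (t / (1 - t))) / 2 * (1 / (1 - t)\<^sup>2)) (at t)"
      by (rule DERIV_chain2[OF DERIV_real_sqrt d1])
    then have "(?F has_real_derivative
        2 / x * (inverse (sqrt (t / (1 - t))) / 2 * (1 / (1 - t)\<^sup>2))) (at t)"
      by (rule DERIV_cmult)
    moreover have "2 / x * (inverse (sqrt (t / (1 - t))) / 2 * (1 / (1 - t)\<^sup>2)) = ?h t"
    proof -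
      have *: "sqrt (1 - t) * sqrt (1 - t) = 1 - t" using t' by simp
      have "inverse (sqrt (t / (1 - t))) = sqrt (1 - t) / sqrt t"
        by (simp add: real_sqrt_divide)
      also have "\<dots> = (sqrt (1 - t) * sqrt (1 - t)) / (sqrt t * sqrt (1 - t))"
        using t' by (subst mult_divide_mult_cancel_right) auto
      also have "\<dots> = (1 - t) / sqrt (t * (1 - t))"
        by (simp only: * real_sqrt_mult)
      finally have 1: "inverse (sqrt (t / (1 - t))) = (1 - t) / sqrt (t * (1 - t))" .
      have 2: "2 / x * (u / s / 2 * (1 / u\<^sup>2)) = 1 / (x * u) * (1 / s)"
        if "u \<noteq> 0" "s \<noteq> 0" for u s
        using that assms by (simp add: power2_eq_square field_simps)
      show ?thesis
        unfolding 1 using t' by (intro 2) auto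
    qed
    ultimately show "(?F has_vector_derivative ?h t) (at t)"
      by (simp add: has_real_derivative_iff_has_vector_derivative)
  qed (use assms in auto)
  moreover have "?F x - ?F 0 = 2 * (1 / sqrt (x * (1 - x)))"
  proof -
    have "2 / (s * s) * (s / u) = 2 * (1 / (s * u))" for s u :: real
      by simp
    from this[of "sqrt x" "sqrt (1 - x)"] show ?thesis
      using assms by (simp add: real_sqrt_divide real_sqrt_mult)
  qed
  ultimately have hi: "(?h has_integral 2 * (1 / sqrt (x * (1 - x)))) {0..x}" by simp
  have hi': "(?h has_integral 2 * (1 / sqrt (x * (1 - x)))) {0<..<x}"
    using hi by (simp add: has_integral_Icc_iff_Ioo)
  have "(\<integral>\<^sup>+t. ennreal (?h t) * indicator {0<..<x} t \<partial>lborel) = ennreal (2 * (1 / sqrt (x * (1 - x))))"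
    using assms by (intro nn_integral_has_integral_lebesgue' hi') auto
  also have "(\<integral>\<^sup>+t. ennreal (?h t) * indicator {0<..<x} t \<partial>lborel)
     = (\<integral>\<^sup>+t. ennreal (indicator {0<..<x} t / (x * (1 - t)) * (1 / sqrt (t * (1 - t)))) * indicator {0<..<1} t \<partial>lborel)"
    using assms by (intro nn_integral_cong) (auto simp: indicator_def)
  also have "\<dots> = (\<integral>\<^sup>+t. ennreal (indicator {0<..<x} t / (x * (1 - t)) * (1 / sqrt (t * (1 - t)))) \<partial>leb01)"
    by (subst nn_integral_restrict_space) (auto simp: nn_integral_completion)
  finally show ?thesis .
qed

lemma weight_integral_right:
  assumes "0 < t" "t < (1::real)"
  shows "(\<integral>\<^sup>+x. ennreal (indicator {0<..<x} t / (x * (1 - t)) * (1 / sqrt (x * (1 - x)))) \<partial>leb01)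
    = ennreal (2 * (1 / sqrt (t * (1 - t))))"
proof -
  let ?k = "\<lambda>x t::real. indicator {0<..<x} t / (x * (1 - t)) * (1 / sqrt (t * (1 - t))) :: real"
  let ?k' = "\<lambda>x. indicator {0<..<x} t / (x * (1 - t)) * (1 / sqrt (x * (1 - x))) :: real"
  have "ennreal (2 * (1 / sqrt (t * (1 - t)))) = (\<integral>\<^sup>+s. ennreal (?k (1 - t) s) \<partial>leb01)"
    using assms by (subst weight_integral_left) (auto simp: mult.commute)
  also have "\<dots> = (\<integral>\<^sup>+s. ennreal (?k (1 - t) s) * indicator {0<..<1} s \<partial>lborel)"
    by (subst nn_integral_restrict_space) (auto simp: nn_integral_completion)
  also have "\<dots> = (\<integral>\<^sup>+x. ennreal (?k (1 - t) (1 + (-1) * x)) * indicator {0<..<1} (1 + (-1) * x) \<partial>lborel)"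
    by (subst nn_integral_real_affine[where c = "-1" and t = 1]) auto
  also have "\<dots> = (\<integral>\<^sup>+x. ennreal (?k' x) * indicator {0<..<1} x \<partial>lborel)"
    using assms by (intro nn_integral_cong) (auto simp: indicator_def mult.commute)
  also have "\<dots> = (\<integral>\<^sup>+x. ennreal (?k' x) \<partial>leb01)"
    by (subst nn_integral_restrict_space) (auto simp: nn_integral_completion)
  finally show ?thesis ..
qed

lemma hardy_type:
  fixes g :: "real \<Rightarrow> ennreal"
  assumes [measurable]: "g \<in> borel_measurable leb01"
  shows "(\<integral>\<^sup>+x. (\<integral>\<^sup>+t. ennreal (indicator {0<..<x} t / (x * (1 - t))) * g t \<partial>leb01)\<^sup>2 \<partial>leb01)
    \<le> 4 * (\<integral>\<^sup>+t. (g t)\<^sup>2 \<partial>leb01)"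
proof -
  interpret N: sigma_finite_measure leb01 by (rule sigma_finite_leb01)
  interpret NN: pair_sigma_finite leb01 leb01 by unfold_locales
  define p where "p t = 1 / sqrt (t * (1 - t))" for t :: real
  define k where "k x t = (if 0 < t \<and> t < x then 1 else 0) / (x * (1 - t))" for x t :: real
  have k_eq: "indicator {0<..<x} t / (x * (1 - t)) = k x t" for x t
    by (auto simp: k_def)
  have idm [measurable]: "(\<lambda>x. x) \<in> borel_measurable leb01"
    by (simp add: measurable_completion measurable_restrict_space1)
  have fsm [measurable]: "fst \<in> borel_measurable (leb01 \<Otimes>\<^sub>M leb01)" "snd \<in> borel_measurable (leb01 \<Otimes>\<^sub>M leb01)"
    using measurable_compose[OF measurable_fst idm] measurable_compose[OF measurable_snd idm] by auto
  have km [measurable]: "(\<lambda>z. k (fst z) (snd z)) \<in> borel_measurable (leb01 \<Otimes>\<^sub>M leb01)"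
    unfolding k_def by measurable
  have km1 [measurable]: "k x \<in> borel_measurable leb01" for x
    unfolding k_def by measurable
  have km2 [measurable]: "(\<lambda>x. k x t) \<in> borel_measurable leb01" for t
    unfolding k_def by measurable
  have pm [measurable]: "p \<in> borel_measurable leb01"
    unfolding p_def by measurable
  have k0: "0 \<le> k x t" if "x \<in> {0<..<1}" "t \<in> {0<..<1}" for x t
    using that by (simp add: k_def)
  have p0: "0 < p t" if "t \<in> {0<..<1}" for t
    using that by (simp add: p_def)
  have wl: "(\<integral>\<^sup>+t. ennreal (k x t * p t) \<partial>leb01) = ennreal (2 * p x)" if "x \<in> {0<..<1}" for x
    using weight_integral_left[of x] that by (simp add: k_eq p_def)
  have wr: "(\<integral>\<^sup>+x. ennreal (k x t * p x) \<partial>leb01) = ennreal (2 * p t)" if "t \<in> {0<..<1}" for t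
    using weight_integral_right[of t] that by (simp add: k_eq p_def)
  have "(\<integral>\<^sup>+x. (\<integral>\<^sup>+t. ennreal (k x t) * g t \<partial>leb01)\<^sup>2 \<partial>leb01)
      \<le> (\<integral>\<^sup>+x. (\<integral>\<^sup>+t. ennreal (2 * p x) * (ennreal (k x t / p t) * (g t)\<^sup>2) \<partial>leb01) \<partial>leb01)"
  proof (rule nn_integral_mono)
    fix x assume "x \<in> space leb01"
    then have x: "x \<in> {0<..<1}" by simp
    have "(\<integral>\<^sup>+t. ennreal (k x t) * g t \<partial>leb01)
        = (\<integral>\<^sup>+t. ennreal (sqrt (k x t * p t)) * (ennreal (sqrt (k x t / p t)) * g t) \<partial>leb01)"
    proof (rule nn_integral_cong)
      fix t assume "t \<in> space leb01"
      then have t: "t \<in> {0<..<1}" by simp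
      have "sqrt (k x t * p t) * sqrt (k x t / p t) = sqrt ((k x t)\<^sup>2)"
        using p0[OF t] by (simp add: real_sqrt_mult[symmetric] power2_eq_square)
      also have "\<dots> = k x t" using k0[OF x t] by simp
      finally show "ennreal (k x t) * g t = ennreal (sqrt (k x t * p t)) * (ennreal (sqrt (k x t / p t)) * g t)"
        using k0[OF x t] p0[OF t] by (simp add: mult.assoc[symmetric] ennreal_mult[symmetric])
    qed
    then have "(\<integral>\<^sup>+t. ennreal (k x t) * g t \<partial>leb01)\<^sup>2
        \<le> (\<integral>\<^sup>+t. (ennreal (sqrt (k x t * p t)))\<^sup>2 \<partial>leb01) * (\<integral>\<^sup>+t. (ennreal (sqrt (k x t / p t)) * g t)\<^sup>2 \<partial>leb01)"
      by (simp only:) (rule Cauchy_Schwarz_nn_integral; measurable)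
    also have "(\<integral>\<^sup>+t. (ennreal (sqrt (k x t * p t)))\<^sup>2 \<partial>leb01) = (\<integral>\<^sup>+t. ennreal (k x t * p t) \<partial>leb01)"
      using k0[OF x] p0 by (intro nn_integral_cong) (auto simp: ennreal_power less_imp_le)
    also have "(\<integral>\<^sup>+t. (ennreal (sqrt (k x t / p t)) * g t)\<^sup>2 \<partial>leb01) = (\<integral>\<^sup>+t. ennreal (k x t / p t) * (g t)\<^sup>2 \<partial>leb01)"
      using k0[OF x] p0 by (intro nn_integral_cong) (auto simp: power_mult_distrib ennreal_power less_imp_le)
    finally show "(\<integral>\<^sup>+t. ennreal (k x t) * g t \<partial>leb01)\<^sup>2
        \<le> (\<integral>\<^sup>+t. ennreal (2 * p x) * (ennreal (k x t / p t) * (g t)\<^sup>2) \<partial>leb01)"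
      using wl[OF x] by (simp add: nn_integral_cmult)
  qed
  also have "\<dots> = (\<integral>\<^sup>+t. (\<integral>\<^sup>+x. ennreal (2 * p x) * (ennreal (k x t / p t) * (g t)\<^sup>2) \<partial>leb01) \<partial>leb01)"
    by (rule NN.Fubini'[symmetric]) measurable
  also have "\<dots> = (\<integral>\<^sup>+t. 4 * (g t)\<^sup>2 \<partial>leb01)"
  proof (rule nn_integral_cong)
    fix t assume "t \<in> space leb01"
    then have t: "t \<in> {0<..<1}" by simp
    have "(\<integral>\<^sup>+x. ennreal (2 * p x) * (ennreal (k x t / p t) * (g t)\<^sup>2) \<partial>leb01)
        = (\<integral>\<^sup>+x. (ennreal (2 / p t) * (g t)\<^sup>2) * ennreal (k x t * p x) \<partial>leb01)"
    proof (rule nn_integral_cong)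
      fix x assume "x \<in> space leb01"
      then have x: "x \<in> {0<..<1}" by simp
      have "ennreal (2 * p x) * ennreal (k x t / p t) = ennreal (2 / p t) * ennreal (k x t * p x)"
        using k0[OF x t] p0[OF t] p0[OF x] by (simp add: ennreal_mult[symmetric] mult_ac)
      then show "ennreal (2 * p x) * (ennreal (k x t / p t) * (g t)\<^sup>2)
          = (ennreal (2 / p t) * (g t)\<^sup>2) * ennreal (k x t * p x)"
        by (metis mult.assoc mult.commute)
    qed
    also have "\<dots> = (ennreal (2 / p t) * (g t)\<^sup>2) * ennreal (2 * p t)"
      using wr[OF t] by (subst nn_integral_cmult) auto
    also have "\<dots> = (ennreal (2 / p t) * ennreal (2 * p t)) * (g t)\<^sup>2"
      by (simp add: mult_ac)
    also have "ennreal (2 / p t) * ennreal (2 * p t) = 4"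
      using p0[OF t] by (simp add: ennreal_mult[symmetric])
    finally show "(\<integral>\<^sup>+x. ennreal (2 * p x) * (ennreal (k x t / p t) * (g t)\<^sup>2) \<partial>leb01) = 4 * (g t)\<^sup>2" .
  qed
  also have "\<dots> = 4 * (\<integral>\<^sup>+t. (g t)\<^sup>2 \<partial>leb01)"
    by (rule nn_integral_cmult) measurable
  finally show ?thesis unfolding k_eq .
qed

lemma cesaro_fun_kernel:
  assumes "0 < x" "x < 1"
  shows "cesaro_fun f x
    = (LINT t|leb01. complex_of_real (indicator {0<..<x} t / (x * (1 - t))) * f t)"
proof -
  have "(LINT t|leb01. complex_of_real (indicator {0<..<x} t / (x * (1 - t))) * f t)
      = (LINT t|lebesgue. indicator {0<..<1} t *\<^sub>R
          (complex_of_real (indicator {0<..<x} t / (x * (1 - t))) * f t))"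
    by (rule integral_restrict_space) auto
  also have "\<dots> = (LINT t|lebesgue. 1 / complex_of_real x *
      (indicator {0<..<x} t *\<^sub>R (f t / (1 - complex_of_real t))))"
    using assms by (intro Bochner_Integration.integral_cong) (auto simp: indicator_def)
  also have "\<dots> = cesaro_fun f x"
    by (simp only: Bochner_Integration.integral_mult_right_zero cesaro_fun_def
        set_lebesgue_integral_def)
  finally show ?thesis ..
qed

lemma id_measurable_leb01: "(\<lambda>x. x) \<in> borel_measurable leb01"
  by (simp add: measurable_completion measurable_restrict_space1)

lemma cesaro_fun_measurable:
  assumes [measurable]: "f \<in> borel_measurable leb01"
  shows "cesaro_fun f \<in> borel_measurable leb01"
proof -
  interpret N: sigma_finite_measure leb01 by (rule sigma_finite_leb01)
  define k :: "real \<Rightarrow> real \<Rightarrow> real"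
    where "k x t = (if 0 < t \<and> t < x then 1 else 0) / (x * (1 - t))" for x t
  have k_eq: "indicator {0<..<x} t / (x * (1 - t)) = k x t" for x t :: real
    by (auto simp: k_def)
  note [measurable] = measurable_compose[OF measurable_fst id_measurable_leb01]
    measurable_compose[OF measurable_snd id_measurable_leb01]
  have fst_m [measurable]: "fst \<in> borel_measurable (leb01 \<Otimes>\<^sub>M leb01)"
    and snd_m [measurable]: "snd \<in> borel_measurable (leb01 \<Otimes>\<^sub>M leb01)"
    by measurable
  have [measurable]: "(\<lambda>z. k (fst z) (snd z)) \<in> borel_measurable (leb01 \<Otimes>\<^sub>M leb01)"
    unfolding k_def by measurable
  have "(\<lambda>x. LINT t|leb01. complex_of_real (k x t) * f t) \<in> borel_measurable leb01"
    by (rule N.borel_measurable_lebesgue_integral) measurable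
  also have "?this \<longleftrightarrow> ?thesis"
    by (intro measurable_cong) (simp add: cesaro_fun_kernel k_eq)
  finally show ?thesis .
qed

lemma cesaro_fun_bound:
  assumes "square_integrable f"
  shows "(\<integral>\<^sup>+x. ennreal ((cmod (cesaro_fun f x))\<^sup>2) \<partial>leb01)
    \<le> 4 * (\<integral>\<^sup>+x. ennreal ((cmod (f x))\<^sup>2) \<partial>leb01)"
proof -
  have [measurable]: "f \<in> borel_measurable leb01"
    using assms by (simp add: square_integrable_def)
  have "(\<integral>\<^sup>+x. ennreal ((cmod (cesaro_fun f x))\<^sup>2) \<partial>leb01)
      \<le> (\<integral>\<^sup>+x. (\<integral>\<^sup>+t. ennreal (indicator {0<..<x} t / (x * (1 - t))) * ennreal (cmod (f t)) \<partial>leb01)\<^sup>2 \<partial>leb01)"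
  proof (rule nn_integral_mono)
    fix x assume "x \<in> space leb01"
    then have x: "0 < x" "x < 1" by auto
    have "ennreal (cmod (cesaro_fun f x))
        \<le> (\<integral>\<^sup>+t. ennreal (cmod (complex_of_real (indicator {0<..<x} t / (x * (1 - t))) * f t)) \<partial>leb01)"
      unfolding cesaro_fun_kernel[OF x]
      by (cases "integrable leb01 (\<lambda>t. complex_of_real (indicator {0<..<x} t / (x * (1 - t))) * f t)")
        (auto intro: integral_norm_bound_ennreal simp: not_integrable_integral_eq)
    also have "\<dots> = (\<integral>\<^sup>+t. ennreal (indicator {0<..<x} t / (x * (1 - t))) * ennreal (cmod (f t)) \<partial>leb01)"
      using x by (intro nn_integral_cong, simp only: norm_mult norm_of_real)
        (auto simp: ennreal_mult[symmetric] indicator_def)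
    finally show "ennreal ((cmod (cesaro_fun f x))\<^sup>2)
      \<le> (\<integral>\<^sup>+t. ennreal (indicator {0<..<x} t / (x * (1 - t))) * ennreal (cmod (f t)) \<partial>leb01)\<^sup>2"
      by (simp add: ennreal_power[symmetric] power_mono)
  qed
  also have "\<dots> \<le> 4 * (\<integral>\<^sup>+t. (ennreal (cmod (f t)))\<^sup>2 \<partial>leb01)"
    by (rule hardy_type) measurable
  finally show ?thesis by (simp add: ennreal_power)
qed

lemma square_integrable_cesaro_fun:
  assumes "square_integrable f"
  shows "square_integrable (cesaro_fun f)"
proof -
  have m [measurable]: "cesaro_fun f \<in> borel_measurable leb01"
    using assms by (intro cesaro_fun_measurable) (simp add: square_integrable_def)
  have "(\<integral>\<^sup>+x. ennreal ((cmod (f x))\<^sup>2) \<partial>leb01) < \<infinity>"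
    using assms by (simp add: square_integrable_def integrable_iff_bounded)
  then have "(\<integral>\<^sup>+x. ennreal ((cmod (cesaro_fun f x))\<^sup>2) \<partial>leb01) < \<infinity>"
    using cesaro_fun_bound[OF assms] by (auto simp: ennreal_mult_less_top elim!: le_less_trans)
  then show ?thesis
    using m by (auto simp: square_integrable_def integrable_iff_bounded)
qed

lemma cesaro_kernel_measurable:
  "(\<lambda>t. complex_of_real (indicator {0<..<x} t / (x * (1 - t)))) \<in> borel_measurable leb01"
proof -
  note [measurable] = id_measurable_leb01
  have "(\<lambda>t. complex_of_real ((if 0 < t \<and> t < x then 1 else 0) / (x * (1 - t)))) \<in> borel_measurable leb01"
    by measurable
  then show ?thesis
    by (simp add: indicator_def of_bool_def)
qed

lift_definition cesaro :: "L2 \<Rightarrow> L2" is cesaro_fun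
proof -
  fix f g assume fg: "L2_rel f g"
  then have [measurable]: "f \<in> borel_measurable leb01" "g \<in> borel_measurable leb01"
    by (auto simp: L2_rel_def square_integrable_def)
  have "cesaro_fun f x = cesaro_fun g x" if x: "0 < x" "x < 1" for x
    unfolding cesaro_fun_kernel[OF x]
  proof (rule integral_cong_AE)
    let ?k = "\<lambda>t. complex_of_real (indicator {0<..<x} t / (x * (1 - t)))"
    note [measurable] = cesaro_kernel_measurable[of x]
    show "(\<lambda>t. ?k t * f t) \<in> borel_measurable leb01" "(\<lambda>t. ?k t * g t) \<in> borel_measurable leb01"
      by measurable
    show "AE t in leb01. ?k t * f t = ?k t * g t"
    proof (rule eventually_mono)
      show "AE t in leb01. f t = g t" using fg by (simp add: L2_rel_def)
    qed simp
  qed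
  then show "L2_rel (cesaro_fun f) (cesaro_fun g)"
    using fg square_integrable_cesaro_fun by (auto simp: L2_rel_def intro!: AE_I2)
qed

lemma cesaro_kernel_integrable:
  assumes "square_integrable f" "0 < x" "x < 1"
  shows "integrable leb01 (\<lambda>t. complex_of_real (indicator {0<..<x} t / (x * (1 - t))) * f t)"
proof -
  let ?k = "\<lambda>t. complex_of_real (indicator {0<..<x} t / (x * (1 - t)))"
  note m = cesaro_kernel_measurable[of x]
  interpret finite_measure leb01
    using finite_measure_lebesgue_on[of "{0<..<1::real}"] by simp
  have "integrable leb01 (\<lambda>t. (cmod (?k t))\<^sup>2)"
  proof (rule integrable_const_bound[where B = "(1 / (x * (1 - x)))\<^sup>2"])
    show "AE t in leb01. norm ((cmod (?k t))\<^sup>2) \<le> (1 / (x * (1 - x)))\<^sup>2"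
    proof (rule AE_I2)
      fix t assume "t \<in> space leb01"
      have "cmod (?k t) \<le> 1 / (x * (1 - x))"
        using assms unfolding norm_of_real
        by (auto simp: indicator_def intro!: divide_left_mono mult_left_mono)
      then show "norm ((cmod (?k t))\<^sup>2) \<le> (1 / (x * (1 - x)))\<^sup>2"
        by (simp add: power_mono)
    qed
  qed (use m in measurable)
  then have "square_integrable ?k" using m by (simp add: square_integrable_def)
  from square_integrable_product[OF assms(1) this] show ?thesis
    by (simp add: mult.commute)
qed

lemma L2_norm_sq: "ennreal ((norm F)\<^sup>2) = (\<integral>\<^sup>+x. ennreal ((cmod (rep_L2 F x))\<^sup>2) \<partial>leb01)"
proof -
  have "(norm F)\<^sup>2 = (LINT x|leb01. (cmod (rep_L2 F x))\<^sup>2)"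
    by (simp add: power2_norm_eq_inner inner_L2_def cinner_self)
  then show ?thesis
    using square_integrable_rep_L2[of F]
    by (subst nn_integral_eq_integral) (auto simp: square_integrable_def)
qed

lemma rep_cesaro: "AE x in leb01. rep_L2 (cesaro F) x = cesaro_fun (rep_L2 F) x"
  unfolding cesaro_def
  by (simp add: rep_abs_L2 square_integrable_cesaro_fun square_integrable_rep_L2)

lemma norm_cesaro_le: "norm (cesaro F) \<le> 2 * norm F"
proof -
  have "ennreal ((norm (cesaro F))\<^sup>2) = (\<integral>\<^sup>+x. ennreal ((cmod (cesaro_fun (rep_L2 F) x))\<^sup>2) \<partial>leb01)"
    unfolding L2_norm_sq using rep_cesaro[of F]
    by (intro nn_integral_cong_AE) (auto elim!: eventually_mono)
  also have "\<dots> \<le> 4 * ennreal ((norm F)\<^sup>2)"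
    unfolding L2_norm_sq by (rule cesaro_fun_bound[OF square_integrable_rep_L2])
  also have "\<dots> = ennreal ((2 * norm F)\<^sup>2)"
    by (simp add: power_mult_distrib ennreal_mult)
  finally have "(norm (cesaro F))\<^sup>2 \<le> (2 * norm F)\<^sup>2" by simp
  then show ?thesis by (rule power2_le_imp_le) simp
qed

lemma cesaro_scaleC: "cesaro (c *\<^sub>C F) = c *\<^sub>C cesaro F"
proof transfer
  fix c f assume "L2_rel f f"
  then have f: "square_integrable f" by (simp add: L2_rel_def)
  have "cesaro_fun (\<lambda>x. c * f x) x = c * cesaro_fun f x" if "0 < x" "x < 1" for x
    unfolding cesaro_fun_kernel[OF that]
    by (subst Bochner_Integration.integral_mult_right_zero[symmetric])
      (auto simp: mult_ac intro!: Bochner_Integration.integral_cong)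
  then show "L2_rel (cesaro_fun (\<lambda>x. c * f x)) (\<lambda>x. c * cesaro_fun f x)"
    using f by (auto simp: L2_rel_def intro!: AE_I2 square_integrable_scale square_integrable_cesaro_fun)
qed

lemma cesaro_add: "cesaro (F + G) = cesaro F + cesaro G"
proof transfer
  fix f g assume "L2_rel f f" "L2_rel g g"
  then have fg: "square_integrable f" "square_integrable g" by (simp_all add: L2_rel_def)
  have "cesaro_fun (\<lambda>x. f x + g x) x = cesaro_fun f x + cesaro_fun g x" if "0 < x" "x < 1" for x
    unfolding cesaro_fun_kernel[OF that]
    using cesaro_kernel_integrable[OF fg(1) that] cesaro_kernel_integrable[OF fg(2) that]
    by (simp add: distrib_left)
  then show "L2_rel (cesaro_fun (\<lambda>x. f x + g x)) (\<lambda>x. cesaro_fun f x + cesaro_fun g x)"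
    using fg by (auto simp: L2_rel_def intro!: AE_I2 square_integrable_add square_integrable_cesaro_fun)
qed

lemma bounded_linear_cesaro: "bounded_linear cesaro"
proof (rule bounded_linear_intro[where K = 2])
  show "cesaro (r *\<^sub>R F) = r *\<^sub>R cesaro F" for r F
    by (simp add: scaleR_L2_scaleC cesaro_scaleC)
qed (use norm_cesaro_le in \<open>auto simp: cesaro_add mult.commute\<close>)

end

theory Submission
  imports Defs
begin

text \<open>
  With the kernel $k(x,t) = 1_{t<x} / (x (1-t))$ the Cesaro operator is the integral operator
  $(Cf)(x) = \int_0^1 k(x,t) f(t)\,dt$. Its adjoint is the operator with the transposed kernel
  $k(t,x) = 1_{x<t} / ((1-x) t)$ (\<open>dual_cesaro_fun_kernel\<close>), which is the asserted formula; two
  analytic points have to be settled.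

  The transposed operator has to map $L^2(0,1)$ to itself. The reflection $x \mapsto 1 - x$
  preserves Lebesgue measure on $(0,1)$ and satisfies $k(1-x, 1-t) = k(t,x)$, so the transposed
  operator is $C$ conjugated by the reflection (\<open>dual_cesaro_fun_reflect\<close>), and square
  integrability is inherited from $C$.

  The order of integration in $\int\int k(x,t) f(t) \overline{g(x)}\,dt\,dx$ has to be exchanged.
  The kernel is nonnegative, hence integrating the absolute value over $t$ gives
  $(C|f|)(x)\,|g(x)|$, a product of two functions in $L^2$, which is integrable; so Fubini's
  theorem applies (\<open>cesaro_fun_adjoint\<close>).
\<close>

definition dual_cesaro_fun :: "(real \<Rightarrow> complex) \<Rightarrow> real \<Rightarrow> complex" where
  "dual_cesaro_fun f x =
     1 / (1 - complex_of_real x) * (LINT t:{x<..<1}|lebesgue. f t / complex_of_real t)"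

text \<open>
  Lebesgue measurability does not follow from continuity of the map, because preimages of null
  sets have to be controlled; nonconstant affine maps do this.
\<close>

lemma reflect_measurable_lebesgue: "(\<lambda>x::real. 1 - x) \<in> lebesgue \<rightarrow>\<^sub>M lebesgue"
proof -
  have "(\<lambda>x. 1 + c * x) \<in> lebesgue \<rightarrow>\<^sub>M lebesgue" if "c \<noteq> 0" for c :: real
    using lebesgue_affine_measurable[of "\<lambda>_. c" "1::real"] that by simp
  from this[of "-1"] show ?thesis by simp
qed

lemma reflect_measurable_leb01: "(\<lambda>x. 1 - x) \<in> leb01 \<rightarrow>\<^sub>M leb01"
  by (intro measurable_restrict_space3 reflect_measurable_lebesgue) auto

text \<open>
  On all of the reals the reflection preserves Lebesgue measure by the affine change of
  variables, and it maps $(0,1)$ onto itself.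
\<close>

lemma distr_reflect_leb01: "distr leb01 leb01 (\<lambda>x. 1 - x) = leb01"
proof (rule measure_eqI)
  fix A assume "A \<in> sets (distr leb01 leb01 (\<lambda>x. 1 - x))"
  then have A: "A \<in> sets leb01" by simp
  then have A': "A \<subseteq> {0<..<1}" "A \<in> sets lebesgue"
    by (auto simp: sets_restrict_space)
  have "lebesgue = distr lebesgue lebesgue (\<lambda>x::real. 1 - x)"
    using lebesgue_real_affine[of "-1" 1] by (simp add: density_1)
  then have "emeasure lebesgue A = emeasure (distr lebesgue lebesgue (\<lambda>x::real. 1 - x)) A"
    by metis
  also have "\<dots> = emeasure lebesgue ((\<lambda>x. 1 - x) -` A)"
    using A' reflect_measurable_lebesgue by (subst emeasure_distr) auto
  finally have *: "emeasure lebesgue A = emeasure lebesgue ((\<lambda>x. 1 - x) -` A)" .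
  have "emeasure (distr leb01 leb01 (\<lambda>x. 1 - x)) A
      = emeasure leb01 ((\<lambda>x. 1 - x) -` A \<inter> space leb01)"
    by (rule emeasure_distr[OF reflect_measurable_leb01 A])
  also have "(\<lambda>x. 1 - x) -` A \<inter> space leb01 = (\<lambda>x. 1 - x) -` A"
    using A' by (auto simp: subset_iff)
  also have "emeasure leb01 ((\<lambda>x. 1 - x) -` A) = emeasure lebesgue ((\<lambda>x. 1 - x) -` A)"
    using A' by (subst emeasure_restrict_space) (auto simp: subset_iff)
  also have "\<dots> = emeasure leb01 A"
    using A' * by (subst emeasure_restrict_space) auto
  finally show "emeasure (distr leb01 leb01 (\<lambda>x. 1 - x)) A = emeasure leb01 A" .
qed simp

lemma integral_reflect_leb01:
  fixes f :: "real \<Rightarrow> complex"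
  assumes "f \<in> borel_measurable leb01"
  shows "(LINT x|leb01. f (1 - x)) = (LINT x|leb01. f x)"
  using integral_distr[OF reflect_measurable_leb01 assms] by (simp add: distr_reflect_leb01)

lemma square_integrable_reflect:
  assumes "square_integrable f"
  shows "square_integrable (\<lambda>x. f (1 - x))"
proof -
  have f: "f \<in> borel_measurable leb01" "integrable leb01 (\<lambda>x. (cmod (f x))\<^sup>2)"
    using assms by (auto simp: square_integrable_def)
  have "integrable leb01 (\<lambda>x. (cmod (f (1 - x)))\<^sup>2)"
    by (rule integrable_distr[OF reflect_measurable_leb01])
      (use f in \<open>simp add: distr_reflect_leb01\<close>)
  then show ?thesis
    using measurable_compose[OF reflect_measurable_leb01 f(1)] by (simp add: square_integrable_def)
qed

lemma dual_cesaro_fun_kernel: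
  assumes "0 < x" "x < 1"
  shows "dual_cesaro_fun f x
    = (LINT t|leb01. complex_of_real (indicator {0<..<t} x / (t * (1 - x))) * f t)"
proof -
  have "(LINT t|leb01. complex_of_real (indicator {0<..<t} x / (t * (1 - x))) * f t)
      = (LINT t|lebesgue. indicator {0<..<1} t *\<^sub>R
          (complex_of_real (indicator {0<..<t} x / (t * (1 - x))) * f t))"
    by (rule integral_restrict_space) auto
  also have "\<dots> = (LINT t|lebesgue. 1 / (1 - complex_of_real x) *
      (indicator {x<..<1} t *\<^sub>R (f t / complex_of_real t)))"
    using assms by (intro Bochner_Integration.integral_cong) (auto simp: indicator_def)
  also have "\<dots> = dual_cesaro_fun f x"
    by (simp only: Bochner_Integration.integral_mult_right_zero dual_cesaro_fun_def
        set_lebesgue_integral_def)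
  finally show ?thesis ..
qed

text \<open>
  The substitution $t \mapsto 1 - t$ together with the symmetry $k(1-x, 1-t) = k(t,x)$ of the
  kernel. It makes the transposed operator inherit from the Cesaro operator that it maps square
  integrable functions to square integrable ones, without a second estimate of the kernel.
\<close>

lemma dual_cesaro_fun_reflect:
  assumes f: "f \<in> borel_measurable leb01" and x: "0 < x" "x < 1"
  shows "dual_cesaro_fun f x = cesaro_fun (\<lambda>t. f (1 - t)) (1 - x)"
proof -
  let ?k = "\<lambda>x t. complex_of_real (indicator {0<..<x} t / (x * (1 - t)))"
  let ?h = "\<lambda>t. ?k (1 - x) t * f (1 - t)"
  have "(\<lambda>t. f (1 - t)) \<in> borel_measurable leb01"
    using measurable_compose[OF reflect_measurable_leb01 f] .
  then have h: "?h \<in> borel_measurable leb01"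
    by (intro borel_measurable_times cesaro_kernel_measurable)
  have "cesaro_fun (\<lambda>t. f (1 - t)) (1 - x) = (LINT t|leb01. ?h t)"
    using x by (intro cesaro_fun_kernel) auto
  also have "\<dots> = (LINT t|leb01. ?h (1 - t))"
    using integral_reflect_leb01[OF h] by simp
  also have "\<dots> = (LINT t|leb01. ?k t x * f t)"
    using x by (intro Bochner_Integration.integral_cong) (auto simp: indicator_def mult.commute)
  also have "\<dots> = dual_cesaro_fun f x"
    using dual_cesaro_fun_kernel[OF x] by simp
  finally show ?thesis ..
qed

lemma square_integrable_dual_cesaro_fun:
  assumes "square_integrable f"
  shows "square_integrable (dual_cesaro_fun f)"
proof -
  let ?h = "\<lambda>x. cesaro_fun (\<lambda>t. f (1 - t)) (1 - x)"
  have "square_integrable ?h"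
    by (intro square_integrable_reflect square_integrable_cesaro_fun assms)
  moreover have eq: "dual_cesaro_fun f x = ?h x" if "x \<in> space leb01" for x
    using that assms by (intro dual_cesaro_fun_reflect) (auto simp: square_integrable_def)
  have "dual_cesaro_fun f \<in> borel_measurable leb01 \<longleftrightarrow> ?h \<in> borel_measurable leb01"
    by (rule measurable_cong) (rule eq)
  moreover have "integrable leb01 (\<lambda>x. (cmod (dual_cesaro_fun f x))\<^sup>2)
      \<longleftrightarrow> integrable leb01 (\<lambda>x. (cmod (?h x))\<^sup>2)"
    by (rule Bochner_Integration.integrable_cong) (simp_all only: eq)
  ultimately show ?thesis
    by (simp add: square_integrable_def)
qed

lemma square_integrable_norm:
  assumes "square_integrable f"
  shows "square_integrable (\<lambda>x. complex_of_real (cmod (f x)))"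
  using assms by (auto simp: square_integrable_def)

text \<open>
  By Tonelli's theorem the double integral of the absolute value is
  $\int (C|f|)(x)\,|g(x)|\,dx$, since $k \ge 0$. This is finite because $C$ maps the square
  integrable function $|f|$ to a square integrable one.
\<close>

lemma integrable_cesaro_product:
  assumes f: "square_integrable f" and g: "square_integrable g"
  shows "integrable (leb01 \<Otimes>\<^sub>M leb01)
    (\<lambda>(x, t). complex_of_real (indicator {0<..<x} t / (x * (1 - t))) * f t * cnj (g x))"
proof -
  interpret N: sigma_finite_measure leb01 by (rule sigma_finite_leb01)
  interpret NN: pair_sigma_finite leb01 leb01 by unfold_locales
  have [measurable]: "f \<in> borel_measurable leb01" "g \<in> borel_measurable leb01"
    using assms by (auto simp: square_integrable_def)
  let ?k = "\<lambda>x t. complex_of_real (indicator {0<..<x} t / (x * (1 - t)))"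
  let ?f = "\<lambda>t. complex_of_real (cmod (f t))"
  (* The set in the indicator varies with x; written as a condition on the pair (x, t), the kernel
     is seen to be jointly measurable. *)
  have k_eq: "indicator {0<..<x} t / (x * (1 - t))
      = (if 0 < t \<and> t < x then 1 else 0) / (x * (1 - t))" for x t :: real
    by auto
  have [measurable]: "fst \<in> borel_measurable (leb01 \<Otimes>\<^sub>M leb01)"
      "snd \<in> borel_measurable (leb01 \<Otimes>\<^sub>M leb01)"
    using measurable_compose[OF measurable_fst id_measurable_leb01]
      measurable_compose[OF measurable_snd id_measurable_leb01] by auto
  have [measurable]: "(\<lambda>z. ?k (fst z) (snd z)) \<in> borel_measurable (leb01 \<Otimes>\<^sub>M leb01)"
    unfolding k_eq by measurable
  have k_int: "integrable leb01 (\<lambda>t. ?k x t * h t)"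
    if "x \<in> space leb01" "square_integrable h" for x h
    using that by (intro cesaro_kernel_integrable) auto
  have cesaro_norm: "(LINT t|leb01. cmod (?k x t * f t * cnj (g x)))
      = cmod (cesaro_fun ?f x * cnj (g x))" if "x \<in> space leb01" for x
  proof -
    have x: "0 < x" "x < 1" using that by auto
    have "complex_of_real (LINT t|leb01. cmod (?k x t * f t))
        = (LINT t|leb01. complex_of_real (cmod (?k x t * f t)))"
      by (rule integral_complex_of_real[symmetric])
    also have "\<dots> = (LINT t|leb01. ?k x t * ?f t)"
      using x by (intro Bochner_Integration.integral_cong, simp, simp only: norm_mult norm_of_real)
        (auto simp: indicator_def)
    also have "\<dots> = cesaro_fun ?f x"
      using cesaro_fun_kernel[OF x] by simp
    finally have "cmod (cesaro_fun ?f x) = \<bar>LINT t|leb01. cmod (?k x t * f t)\<bar>"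
      by (metis norm_of_real)
    also have "\<dots> = (LINT t|leb01. cmod (?k x t * f t))"
      by (simp only: abs_of_nonneg Bochner_Integration.integral_nonneg norm_ge_zero)
    finally show ?thesis
      by (simp only: norm_mult complex_mod_cnj Bochner_Integration.integral_mult_left_zero)
  qed
  have "(\<lambda>z. ?k (fst z) (snd z) * f (snd z) * cnj (g (fst z))) \<in> borel_measurable (leb01 \<Otimes>\<^sub>M leb01)"
    by measurable
  then have m: "(\<lambda>(x, t). ?k x t * f t * cnj (g x)) \<in> borel_measurable (leb01 \<Otimes>\<^sub>M leb01)"
    by (simp only: case_prod_unfold)
  show ?thesis
  proof (rule NN.Fubini_integrable[OF m])
    have "integrable leb01 (\<lambda>x. cmod (cesaro_fun ?f x * cnj (g x)))"
      using f g by (intro integrable_norm square_integrable_product square_integrable_cesaro_fun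
          square_integrable_norm)
    also have "?this \<longleftrightarrow> integrable leb01 (\<lambda>x. LINT t|leb01. cmod (?k x t * f t * cnj (g x)))"
      by (rule Bochner_Integration.integrable_cong) (simp_all only: cesaro_norm)
    finally show "integrable leb01
        (\<lambda>x. LINT t|leb01. norm (case (x, t) of (x, t) \<Rightarrow> ?k x t * f t * cnj (g x)))"
      by (simp only: case_prod_conv)
    show "AE x in leb01. integrable leb01 (\<lambda>t. case (x, t) of (x, t) \<Rightarrow> ?k x t * f t * cnj (g x))"
      by (rule AE_I2) (use k_int[OF _ f] in \<open>simp del: of_real_divide of_real_mult\<close>)
  qed
qed

lemma cesaro_fun_adjoint:
  assumes f: "square_integrable f" and g: "square_integrable g"
  shows "(LINT x|leb01. cesaro_fun f x * cnj (g x)) = (LINT t|leb01. f t * cnj (dual_cesaro_fun g t))"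
proof -
  interpret N: sigma_finite_measure leb01 by (rule sigma_finite_leb01)
  interpret NN: pair_sigma_finite leb01 leb01 by unfold_locales
  let ?k = "\<lambda>x t. complex_of_real (indicator {0<..<x} t / (x * (1 - t)))"
  have "(LINT x|leb01. cesaro_fun f x * cnj (g x))
      = (LINT x|leb01. LINT t|leb01. ?k x t * f t * cnj (g x))"
    by (intro Bochner_Integration.integral_cong)
      (auto simp: cesaro_fun_kernel simp del: of_real_divide of_real_mult)
  also have "\<dots> = (LINT t|leb01. LINT x|leb01. ?k x t * f t * cnj (g x))"
    using NN.Fubini_integral[OF integrable_cesaro_product[OF f g]] by simp
  also have "\<dots> = (LINT t|leb01. f t * cnj (dual_cesaro_fun g t))"
  proof (rule Bochner_Integration.integral_cong)
    fix t assume "t \<in> space leb01"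
    then have t: "0 < t" "t < 1" by auto
    have "f t * cnj (dual_cesaro_fun g t) = f t * (LINT x|leb01. cnj (?k x t * g x))"
      unfolding dual_cesaro_fun_kernel[OF t] by (simp only: Bochner_Integration.integral_cnj)
    also have "\<dots> = (LINT x|leb01. f t * cnj (?k x t * g x))"
      by (rule Bochner_Integration.integral_mult_right_zero[symmetric])
    also have "\<dots> = (LINT x|leb01. ?k x t * f t * cnj (g x))"
      by (simp add: mult_ac)
    finally show "(LINT x|leb01. ?k x t * f t * cnj (g x)) = f t * cnj (dual_cesaro_fun g t)" ..
  qed simp
  finally show ?thesis .
qed

lemma cinner_eq_rep_L2: "cinner F G = (LINT x|leb01. rep_L2 F x * cnj (rep_L2 G x))"
  by (simp add: cinner_def)

text \<open>
  Representatives of classes in $L^2$ are only determined almost everywhere, which integrals, and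
  hence inner products, do not notice; so \<open>cesaro_fun_adjoint\<close> passes to the quotient.
\<close>

lemma hilbert_adjoint_cesaro:
  "hilbert_adjoint cesaro = (\<lambda>G. abs_L2 (dual_cesaro_fun (rep_L2 G)))"
proof (rule hilbert_adjoint_eqI)
  fix F G
  have [measurable]: "rep_L2 F \<in> borel_measurable leb01" for F
    using square_integrable_rep_L2 by (simp add: square_integrable_def)
  have d: "square_integrable (dual_cesaro_fun (rep_L2 G))"
    by (intro square_integrable_dual_cesaro_fun square_integrable_rep_L2)
  have c: "square_integrable (cesaro_fun (rep_L2 F))"
    by (intro square_integrable_cesaro_fun square_integrable_rep_L2)
  have [measurable]: "dual_cesaro_fun (rep_L2 G) \<in> borel_measurable leb01"
      "cesaro_fun (rep_L2 F) \<in> borel_measurable leb01"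
    using c d by (auto simp: square_integrable_def)
  have "cinner (cesaro F) G = (LINT x|leb01. cesaro_fun (rep_L2 F) x * cnj (rep_L2 G x))"
    unfolding cinner_eq_rep_L2
    by (rule integral_cong_AE) (use rep_cesaro[of F] in \<open>auto elim: eventually_mono\<close>)
  also have "\<dots> = (LINT x|leb01. rep_L2 F x * cnj (dual_cesaro_fun (rep_L2 G) x))"
    by (intro cesaro_fun_adjoint square_integrable_rep_L2)
  also have "\<dots> = cinner F (abs_L2 (dual_cesaro_fun (rep_L2 G)))"
    unfolding cinner_eq_rep_L2
    by (rule integral_cong_AE) (use rep_abs_L2[OF d] in \<open>auto elim: eventually_mono\<close>)
  finally show "cinner (cesaro F) G = cinner F (abs_L2 (dual_cesaro_fun (rep_L2 G)))" .
qed

theorem theorem2p4: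
  fixes F :: L2
  shows "AE x in leb01.
    rep_L2 (hilbert_adjoint cesaro F) x =
      1 / (1 - complex_of_real x) * (LINT t:{x<..<1}|lebesgue. rep_L2 F t / complex_of_real t)"
  using rep_abs_L2[OF square_integrable_dual_cesaro_fun[OF square_integrable_rep_L2[of F]]]
  by (simp only: hilbert_adjoint_cesaro dual_cesaro_fun_def)

end
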